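(* Let $n>c_1\ge c_2$ be natural numbers. If $\mathcal D(n,c_1,c_2)$ is not fully graphic, then $\mathcal D(n,c_1,c_2)$ contains a split degree sequence.
   Context: $\mathcal D(n,c_1,c_2)$ is the set of integer sequences $(d_1,\dots,d_n)$ with $c_1\ge d_1\ge\dots\ge d_n\ge c_2$ and $\sum_i d_i$ even; it is fully graphic if all of its elements are graphic (degree sequences of simple graphs). A split graph is a graph whose vertex set can be partitioned into a clique and an independent set. A split degree sequence is a graphic sequence whose realizations are split graphs (if one realization is split, all are). *)

theory Defs
  imports "HOL-Library.Ramsey" "HOL-Library.Multiset"
begin

definition simple_graph :: "'a set \<Rightarrow> 'a set set \<Rightarrow> bool" where
  "simple_graph V E \<longleftrightarrow> finite V \<and> E \<subseteq> [V]\<^bsup>2\<^esup>"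

definition degree :: "'a set set \<Rightarrow> 'a \<Rightarrow> nat" where
  "degree E v = card {e \<in> E. v \<in> e}"

text \<open>The vertices are unlabelled: only the multiset of degrees has to agree with the entries
  of the sequence.\<close>

definition realizes :: "'a set \<Rightarrow> 'a set set \<Rightarrow> int list \<Rightarrow> bool" where
  "realizes V E d \<longleftrightarrow> simple_graph V E \<and> {#int (degree E v). v \<in># mset_set V#} = mset d"

definition split_graph :: "'a set \<Rightarrow> 'a set set \<Rightarrow> bool" where
  "split_graph V E \<longleftrightarrow> simple_graph V E \<and>
     (\<exists>K I. K \<union> I = V \<and> K \<inter> I = {} \<and> clique K E \<and> indep I E)"

text \<open>A definition cannot quantify over types, so realizations are taken with vertices of type
  \<^typ>\<open>nat\<close>; every finite graph is isomorphic to one of these.\<close>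

definition graphic :: "int list \<Rightarrow> bool" where
  "graphic d \<longleftrightarrow> (\<exists>(V :: nat set) E. realizes V E d)"

definition split_degree_sequence :: "int list \<Rightarrow> bool" where
  "split_degree_sequence d \<longleftrightarrow>
     graphic d \<and> (\<forall>(V :: nat set) E. realizes V E d \<longrightarrow> split_graph V E)"

definition degree_interval :: "nat \<Rightarrow> int \<Rightarrow> int \<Rightarrow> int list set" (\<open>\<D>\<close>) where
  "\<D> n c1 c2 = {d. length d = n \<and> sorted_wrt (\<ge>) d \<and>
     (\<forall>x \<in> set d. c2 \<le> x \<and> x \<le> c1) \<and> even (sum_list d)}"

definition fully_graphic :: "int list set \<Rightarrow> bool" where
  "fully_graphic D \<longleftrightarrow> (\<forall>d \<in> D. graphic d)"

end

(* If D(n,c1,c2) has a non-graphic member, the inequality of Erdos and Gallai fails for it at some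
   k. Bounding the first k entries by c1 and the others by c2 from below forces c2 < k and
   (n - k) c2 <= k (c1 - k + 1). Hence a clique on k vertices can absorb n - k further vertices of
   degree c2 each, with the cross edges spread evenly so that no clique vertex exceeds degree c1;
   this is a split graph with all degrees between c2 and c1. Its degree sequence is split because a
   partition (K, I) is split exactly when the degree sums over K and I differ by |K|(|K| - 1), which
   only depends on the degrees. The sufficiency of the Erdos-Gallai condition follows the
   argument of Tripathi, Venugopalan and West: the vertices are saturated one after the other by
   edge exchanges. *)

theory Submission
  imports Defs
begin

section \<open>Degrees and neighbourhoods in simple graphs\<close>

lemma simple_graph_finite:
  assumes "simple_graph V E"
  shows "finite V" "finite E"
  using assms finite_imp_finite_nsets[of V 2]
  by (auto simp: simple_graph_def intro: finite_subset)

lemma simple_graph_edgeD: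
  assumes "simple_graph V E" "{a, b} \<in> E"
  shows "a \<in> V" "b \<in> V" "a \<noteq> b"
  using assms doubleton_in_nsets_2[of a b V] unfolding simple_graph_def by blast+

lemma simple_graph_edgeE:
  assumes "simple_graph V E" "e \<in> E"
  obtains a b where "e = {a, b}" "a \<in> V" "b \<in> V" "a \<noteq> b"
  using assms unfolding simple_graph_def nsets_def by (auto simp: card_2_iff)

lemma simple_graph_insert [simp]:
  "simple_graph V (insert {a, b} E) \<longleftrightarrow> simple_graph V E \<and> a \<in> V \<and> b \<in> V \<and> a \<noteq> b"
  by (auto simp: simple_graph_def)

lemma simple_graph_Diff: "simple_graph V E \<Longrightarrow> simple_graph V (E - F)"
  by (auto simp: simple_graph_def)

lemma degree_insert:
  assumes "finite E" "e \<notin> E"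
  shows "degree (insert e E) v = degree E v + of_bool (v \<in> e)"
proof -
  have "{x \<in> insert e E. v \<in> x} = (if v \<in> e then insert e {x \<in> E. v \<in> x} else {x \<in> E. v \<in> x})"
    by auto
  with assms show ?thesis by (simp add: degree_def)
qed

lemma degree_remove:
  assumes "finite E" "e \<in> E"
  shows "degree (E - {e}) v = degree E v - of_bool (v \<in> e)"
  using degree_insert[of "E - {e}" e v] assms by (simp add: insert_absorb)

lemma degree_pos:
  assumes "finite E" "e \<in> E" "v \<in> e"
  shows "0 < degree E v"
  using assms by (auto simp: degree_def card_gt_0_iff)

lemma degree_eq_card_neighbours:
  assumes "simple_graph V E"
  shows "degree E v = card {w. {v, w} \<in> E}"
proof -
  have inj: "inj_on (\<lambda>w. {v, w}) {w. {v, w} \<in> E}"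
    by (auto simp: inj_on_def doubleton_eq_iff)
  have "(\<lambda>w. {v, w}) ` {w. {v, w} \<in> E} = {e \<in> E. v \<in> e}"
  proof (intro equalityI subsetI)
    fix e assume e: "e \<in> {e \<in> E. v \<in> e}"
    then obtain a b where "e = {a, b}"
      using simple_graph_edgeE[OF assms] by blast
    with e obtain w where "e = {v, w}"
      by blast
    with e show "e \<in> (\<lambda>w. {v, w}) ` {w. {v, w} \<in> E}"
      by blast
  qed auto
  then show ?thesis
    using card_image[OF inj] by (simp add: degree_def)
qed

lemma finite_neighbours:
  assumes "simple_graph V E"
  shows "finite {w. {v, w} \<in> E}"
proof (rule finite_subset)
  show "{w. {v, w} \<in> E} \<subseteq> V"
    using simple_graph_edgeD(2)[OF assms] by blast
qed (rule simple_graph_finite(1)[OF assms])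

text \<open>If every neighbour of \<open>i\<close> other than \<open>r\<close> were also adjacent to
  \<open>r\<close>, the neighbourhoods with \<open>r\<close> and \<open>i\<close> removed would be
  nested. Adjacency of \<open>i\<close> and \<open>r\<close> removes a point from both or from
  neither, so the degrees would compare the wrong way. The vertex \<open>u\<close> is what the edge
  exchanges move from \<open>i\<close> to \<open>r\<close>.\<close>

lemma private_neighbour:
  assumes E: "simple_graph V E" and less: "degree E r < degree E i"
  obtains u where "{i, u} \<in> E" "{r, u} \<notin> E" "u \<noteq> r"
proof -
  let ?N = "\<lambda>v. {w. {v, w} \<in> E}"
  have "\<exists>u. {i, u} \<in> E \<and> {r, u} \<notin> E \<and> u \<noteq> r"
  proof (rule ccontr)
    assume "\<not> ?thesis"
    then have "?N i - {r} \<subseteq> ?N r - {i}"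
      using simple_graph_edgeD(3)[OF E] by blast
    then have "card (?N i - {r}) \<le> card (?N r - {i})"
      using finite_neighbours[OF E] by (intro card_mono) auto
    moreover have "r \<in> ?N i \<longleftrightarrow> i \<in> ?N r"
      by (simp add: insert_commute)
    \<comment> \<open>Positive cardinalities keep the natural subtraction exact when one point is
      removed from each side.\<close>
    moreover have "card (?N i) > 0"
      using less degree_eq_card_neighbours[OF E, of i] by simp
    moreover have "i \<in> ?N r \<Longrightarrow> card (?N r) > 0"
      using finite_neighbours[OF E, of r] by (auto simp: card_gt_0_iff)
    ultimately have "card (?N i) \<le> card (?N r)"
      using finite_neighbours[OF E] by (cases "r \<in> ?N i") (auto simp: card_Diff_singleton)
    then show False
      using less degree_eq_card_neighbours[OF E] by simp
  qed
  then show thesis using that by blast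
qed

lemma sum_degree_eq_sum_card:
  assumes "finite V" "finite E"
  shows "(\<Sum>v\<in>V. degree E v) = (\<Sum>e\<in>E. card (e \<inter> V))"
proof -
  have "(\<Sum>v\<in>V. degree E v) = (\<Sum>v\<in>V. \<Sum>e\<in>E. of_bool (v \<in> e))"
    using assms by (simp add: degree_def Collect_conj_eq)
  also have "\<dots> = (\<Sum>e\<in>E. \<Sum>v\<in>V. of_bool (v \<in> e))"
    by (rule sum.swap)
  also have "\<dots> = (\<Sum>e\<in>E. card (e \<inter> V))"
    using assms by (simp add: Int_commute)
  finally show ?thesis .
qed

lemma even_sum_degree:
  assumes "simple_graph V E"
  shows "even (\<Sum>v\<in>V. degree E v)"
proof -
  have "card (e \<inter> V) = 2" if "e \<in> E" for e
    using assms that by (elim simple_graph_edgeE) auto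
  then show ?thesis
    using sum_degree_eq_sum_card[of V E] simple_graph_finite[OF assms] by simp
qed

section \<open>Split partitions recognised by degree sums\<close>

text \<open>Summed over edges, an edge inside \<open>K\<close> counts +2, an edge inside
  \<open>I\<close> counts -2, and a cross edge contributes one to each sum and cancels.\<close>

lemma degree_sum_difference:
  assumes E: "simple_graph (K \<union> I) E" and disj: "K \<inter> I = {}"
  shows "(\<Sum>v\<in>K. int (degree E v)) - (\<Sum>v\<in>I. int (degree E v))
    = 2 * int (card {e \<in> E. e \<subseteq> K}) - 2 * int (card {e \<in> E. e \<subseteq> I})"
proof -
  have fin: "finite K" "finite I" "finite E"
    using simple_graph_finite[OF E] by auto
  have "int (card (e \<inter> K)) - int (card (e \<inter> I)) = 2 * of_bool (e \<subseteq> K) - 2 * of_bool (e \<subseteq> I)"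
    if "e \<in> E" for e
    using E that
  proof (rule simple_graph_edgeE)
    fix a b assume "e = {a, b}" "a \<in> K \<union> I" "b \<in> K \<union> I" "a \<noteq> b"
    then show ?thesis
      using disj by (cases "a \<in> K"; cases "b \<in> K") (auto simp: Int_insert_left)
  qed
  then have "(\<Sum>e\<in>E. int (card (e \<inter> K)) - int (card (e \<inter> I)))
      = (\<Sum>e\<in>E. 2 * of_bool (e \<subseteq> K) - 2 * of_bool (e \<subseteq> I))"
    by (rule sum.cong[OF refl])
  moreover have "(\<Sum>e\<in>E. 2 * of_bool (e \<subseteq> X)) = 2 * int (card {e \<in> E. e \<subseteq> X})" for X
    using fin by (simp add: Collect_conj_eq flip: sum_distrib_left)
  moreover have "(\<Sum>v\<in>X. int (degree E v)) = (\<Sum>e\<in>E. int (card (e \<inter> X)))" if "finite X" for X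
    unfolding of_nat_sum[symmetric] sum_degree_eq_sum_card[OF that fin(3)] ..
  ultimately show ?thesis
    using fin by (simp only: sum_subtractf)
qed

lemma split_graphI:
  assumes "simple_graph V E" "K \<union> I = V" "K \<inter> I = {}" "clique K E" "indep I E"
  shows "split_graph V E"
  unfolding split_graph_def using assms by (intro conjI exI[of _ K] exI[of _ I])

lemma clique_iff_nsets: "clique K E \<longleftrightarrow> [K]\<^bsup>2\<^esup> \<subseteq> E"
proof
  assume *: "clique K E"
  show "[K]\<^bsup>2\<^esup> \<subseteq> E"
  proof
    fix e assume "e \<in> [K]\<^bsup>2\<^esup>"
    then obtain x y where "x \<in> K" "y \<in> K" "x \<noteq> y" "e = {x, y}"
      by (auto simp: nsets_2_eq)
    then show "e \<in> E"
      using * by (simp add: clique_def)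
  qed
next
  assume "[K]\<^bsup>2\<^esup> \<subseteq> E"
  then have "e \<in> E" if "e \<in> [K]\<^bsup>2\<^esup>" for e
    using that by (rule subsetD)
  then show "clique K E"
    by (simp add: clique_def)
qed

lemma inside_edges_subset_nsets:
  assumes "simple_graph V E"
  shows "{e \<in> E. e \<subseteq> K} \<subseteq> [K]\<^bsup>2\<^esup>"
  using assms by (auto simp: simple_graph_def nsets_def)

lemma inside_edges_clique:
  assumes "simple_graph V E" "clique K E"
  shows "{e \<in> E. e \<subseteq> K} = [K]\<^bsup>2\<^esup>"
proof
  show "[K]\<^bsup>2\<^esup> \<subseteq> {e \<in> E. e \<subseteq> K}"
  proof
    fix e assume "e \<in> [K]\<^bsup>2\<^esup>"
    moreover from this have "e \<subseteq> K"
      by (simp add: nsets_def)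
    ultimately show "e \<in> {e \<in> E. e \<subseteq> K}"
      using subsetD[OF iffD1[OF clique_iff_nsets assms(2)]] by simp
  qed
qed (rule inside_edges_subset_nsets[OF assms(1)])

lemma inside_edges_indep:
  assumes "simple_graph V E"
  shows "{e \<in> E. e \<subseteq> I} = {} \<longleftrightarrow> indep I E"
proof
  assume "{e \<in> E. e \<subseteq> I} = {}"
  then have "e \<notin> E" if "e \<subseteq> I" for e
    using that by auto
  then show "indep I E"
    by (simp add: indep_def)
next
  assume "indep I E"
  show "{e \<in> E. e \<subseteq> I} = {}"
  proof (rule equals0I)
    fix e assume "e \<in> {e \<in> E. e \<subseteq> I}"
    then have e: "e \<in> E" "e \<subseteq> I" by auto
    obtain a b where ab: "e = {a, b}" "a \<in> V" "b \<in> V" "a \<noteq> b"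
      using assms e(1) by (rule simple_graph_edgeE)
    show False
      using \<open>indep I E\<close> e ab(1,4) by (simp add: indep_def)
  qed
qed

lemma split_degree_sum_difference:
  assumes E: "simple_graph (K \<union> I) E" and disj: "K \<inter> I = {}"
    and "clique K E" "indep I E"
  shows "(\<Sum>v\<in>K. int (degree E v)) - (\<Sum>v\<in>I. int (degree E v)) = 2 * int (card K choose 2)"
proof -
  have "card {e \<in> E. e \<subseteq> I} = 0"
    by (simp only: iffD2[OF inside_edges_indep[OF E] assms(4)] card.empty)
  moreover have "card {e \<in> E. e \<subseteq> K} = card K choose 2"
    by (simp only: inside_edges_clique[OF E assms(3)] card_nsets)
  ultimately show ?thesis
    using degree_sum_difference[OF E disj] by linarith
qed

text \<open>The difference of the degree sums is always at most \<^term>\<open>2 * (card K choose 2)\<close>, so the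
  hypothesis is the extremal case.\<close>

lemma split_if_degree_sum_difference:
  assumes E: "simple_graph (K \<union> I) E" and disj: "K \<inter> I = {}"
    and eq: "(\<Sum>v\<in>K. int (degree E v)) - (\<Sum>v\<in>I. int (degree E v)) = 2 * int (card K choose 2)"
  shows "split_graph (K \<union> I) E"
proof -
  have fin: "finite K" "finite E"
    using simple_graph_finite[OF E] by auto
  have sub: "{e \<in> E. e \<subseteq> K} \<subseteq> [K]\<^bsup>2\<^esup>"
    by (rule inside_edges_subset_nsets[OF E])
  have le: "card {e \<in> E. e \<subseteq> K} \<le> card ([K]\<^bsup>2\<^esup>)"
    by (intro card_mono sub finite_imp_finite_nsets fin)
  then have "card {e \<in> E. e \<subseteq> K} = card ([K]\<^bsup>2\<^esup>)" and 0: "card {e \<in> E. e \<subseteq> I} = 0"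
    using degree_sum_difference[OF E disj] eq by (auto simp: card_nsets)
  then have "{e \<in> E. e \<subseteq> K} = [K]\<^bsup>2\<^esup>"
    by (intro card_subset_eq sub finite_imp_finite_nsets fin)
  then have "clique K E"
    unfolding clique_iff_nsets by blast
  moreover have "indep I E"
    using 0 fin inside_edges_indep[OF E, of I] by simp
  ultimately show ?thesis
    using E disj by (intro split_graphI) simp_all
qed

text \<open>Carries a split partition from one realization to another with the same degree multiset.
  The decomposition of the image lifts to one of \<open>mset_set V\<close>; all multiplicities there
  are at most one, so the two parts are the multisets of disjoint sets.\<close>

lemma image_mset_set_eq_plus:
  assumes "finite V" "image_mset f (mset_set V) = M + N"
  obtains K I where "V = K \<union> I" "K \<inter> I = {}"
    "image_mset f (mset_set K) = M" "image_mset f (mset_set I) = N"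
proof -
  from image_mset_eq_plusD[OF assms(2)]
  obtain M' N' where MN: "mset_set V = M' + N'" "M = image_mset f M'" "N = image_mset f N'"
    by (elim exE conjE) (rule that)
  have V: "V = set_mset M' \<union> set_mset N'"
    using arg_cong[OF MN(1), of set_mset] assms(1) by simp
  have count: "count M' x + count N' x \<le> 1" for x
  proof -
    have "count M' x + count N' x = count (mset_set V) x"
      by (simp only: MN(1) count_union)
    also have "\<dots> \<le> 1"
      by (simp add: count_mset_set')
    finally show ?thesis .
  qed
  have simple: "mset_set (set_mset X) = X" if "\<And>x. count X x \<le> 1" for X :: "'a multiset"
  proof (rule multiset_eqI)
    fix x
    show "count (mset_set (set_mset X)) x = count X x"
      using that[of x] count_greater_eq_one_iff[of X x] count_eq_zero_iff[of X x]
      by (cases "x \<in># X") (simp_all del: count_eq_zero_iff count_greater_eq_one_iff count_greater_eq_Suc_zero_iff)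
  qed
  have disj: "set_mset M' \<inter> set_mset N' = {}"
  proof (rule equals0I)
    fix x assume "x \<in> set_mset M' \<inter> set_mset N'"
    then have "0 < count M' x" "0 < count N' x"
      by (simp_all only: count_greater_zero_iff Int_iff)
    then show False
      using count[of x] by linarith
  qed
  have M: "mset_set (set_mset M') = M'"
    by (rule simple) (use count in \<open>metis add_leD1\<close>)
  have N: "mset_set (set_mset N') = N'"
    by (rule simple) (use count in \<open>metis add_leD2\<close>)
  show thesis
    using V disj by (rule that) (simp_all only: M N MN)
qed

lemma split_degree_sequence_if_split_realization:
  assumes real: "realizes (V :: nat set) E d" and split: "split_graph V E"
  shows "split_degree_sequence d"
proof -
  obtain K I where KI: "V = K \<union> I" "K \<inter> I = {}" "clique K E" "indep I E"
    using split by (auto simp: split_graph_def)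
  have E: "simple_graph V E"
    using real by (simp add: realizes_def)
  have fin: "finite K" "finite I"
    using simple_graph_finite(1)[OF E] KI by auto
  let ?deg = "\<lambda>F X. image_mset (\<lambda>v. int (degree F v)) (mset_set X)"
  have "split_graph V' E'" if real': "realizes V' E' d" for V' :: "nat set" and E'
  proof -
    have E': "simple_graph V' E'"
      using real' by (simp add: realizes_def)
    have "?deg E' V' = ?deg E K + ?deg E I"
      using real real' KI(1,2) fin by (simp add: realizes_def mset_set_Union)
    then obtain K' I' where KI': "V' = K' \<union> I'" "K' \<inter> I' = {}"
      "?deg E' K' = ?deg E K" "?deg E' I' = ?deg E I"
      by (rule image_mset_set_eq_plus[OF simple_graph_finite(1)[OF E']])
    \<comment> \<open>The split criterion sees only the size of the clique side and the two degree
      sums, and all three can be read off the degree multisets.\<close>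
    have "card K' = card K"
      using arg_cong[OF KI'(3), of size] by simp
    moreover have "(\<Sum>v\<in>K'. int (degree E' v)) = (\<Sum>v\<in>K. int (degree E v))"
      using arg_cong[OF KI'(3), of sum_mset] by (simp add: sum_unfold_sum_mset)
    moreover have "(\<Sum>v\<in>I'. int (degree E' v)) = (\<Sum>v\<in>I. int (degree E v))"
      using arg_cong[OF KI'(4), of sum_mset] by (simp add: sum_unfold_sum_mset)
    ultimately have "split_graph (K' \<union> I') E'"
      using split_degree_sum_difference[of K I E] E E' KI KI'
      by (intro split_if_degree_sum_difference) auto
    then show ?thesis
      using KI' by simp
  qed
  then show ?thesis
    using real by (auto simp: split_degree_sequence_def graphic_def)
qed

section \<open>Sufficiency of the Erdos-Gallai inequalities\<close>

text \<open>The invariant of the saturation process: \<open>r\<close> is the vertex being worked on.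
  Keeping the later vertices independent makes \<open>{..r}\<close> and \<open>{r<..<n}\<close>
  candidates for a split partition.\<close>

definition partial_realization :: "(nat \<Rightarrow> nat) \<Rightarrow> nat \<Rightarrow> nat \<Rightarrow> nat set set \<Rightarrow> bool" where
  "partial_realization f n r E \<longleftrightarrow> simple_graph {..<n} E \<and> (\<forall>v<n. degree E v \<le> f v) \<and>
     (\<forall>v<r. degree E v = f v) \<and> (\<forall>v w. {v, w} \<in> E \<longrightarrow> v \<le> r \<or> w \<le> r)"

text \<open>Vertex \<open>i\<close> trades \<open>u\<close> for \<open>k\<close>, and
  \<open>u\<close> trades \<open>i\<close> for \<open>r\<close>, so only \<open>r\<close> and
  \<open>k\<close> gain. With \<open>k = r\<close> the gain is two. The condition
  \<open>k \<noteq> i\<close> covers the degenerate case where \<open>{i, k}\<close> is a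
  singleton.\<close>

lemma degree_edge_exchange:
  assumes E: "simple_graph V E" and u: "{i, u} \<in> E" "{r, u} \<notin> E" "u \<noteq> r"
    and ik: "{i, k} \<notin> E" "i \<noteq> r" "k \<noteq> u"
  shows "degree (insert {r, u} (insert {i, k} (E - {{i, u}}))) v
    = degree E v + of_bool (v = r) + of_bool (v = k \<and> k \<noteq> i)"
proof -
  have fin: "finite E" and "i \<noteq> u"
    using simple_graph_finite(2)[OF E] simple_graph_edgeD(3)[OF E u(1)] by auto
  \<comment> \<open>Makes the subtraction for the removed edge exact at both of its ends.\<close>
  have pos: "degree E i > 0" "degree E u > 0"
    using degree_pos[OF fin u(1)] by auto
  have "degree (insert {r, u} (insert {i, k} (E - {{i, u}}))) v
      = degree E v - of_bool (v \<in> {i, u}) + of_bool (v \<in> {i, k}) + of_bool (v \<in> {r, u})"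
    using fin u ik \<open>i \<noteq> u\<close> by (simp add: degree_insert degree_remove doubleton_eq_iff)
  with pos ik u show ?thesis
    using \<open>i \<noteq> u\<close> by (cases "v = i"; cases "v = u"; cases "v = k"; cases "v = r") auto
qed

text \<open>Each edge exchange below raises the degree of \<^term>\<open>r\<close> and keeps all degrees below \<^term>\<open>r\<close>.
  If none applies, the vertices up to \<^term>\<open>r\<close> form a clique and every later vertex \<^term>\<open>v\<close> has degree
  \<^term>\<open>min (r + 1) (f v)\<close>, so the degree deficit at \<^term>\<open>r\<close> violates the inequality of
  Erdos and Gallai.\<close>

lemma stuck_partial_realization:
  fixes f :: "nat \<Rightarrow> nat"
  assumes part: "partial_realization f n r E" and "r < n"
    and mono: "\<And>i j. i \<le> j \<Longrightarrow> j < n \<Longrightarrow> f j \<le> f i"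
    and even: "even (\<Sum>v<n. f v)" and less: "degree E r < f r"
    and stuck: "\<And>E'. partial_realization f n r E' \<Longrightarrow> degree E' r \<le> degree E r"
  shows "r * (r + 1) + (\<Sum>v\<in>{r<..<n}. min (r + 1) (f v)) < (\<Sum>v\<le>r. f v)"
proof -
  have E: "simple_graph {..<n} E" and le: "\<And>v. v < n \<Longrightarrow> degree E v \<le> f v"
    and eq: "\<And>v. v < r \<Longrightarrow> degree E v = f v"
    and low: "\<And>v w. {v, w} \<in> E \<Longrightarrow> v \<le> r \<or> w \<le> r"
    using part by (auto simp: partial_realization_def)
  have fin: "finite E"
    using simple_graph_finite(2)[OF E] .
  have mem: "v < n" "w < n" "v \<noteq> w" if "{v, w} \<in> E" for v w
    using simple_graph_edgeD[OF E that] by auto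
  \<comment> \<open>Maximality of \<open>degree E r\<close>, restated for exchanges: degrees below
    \<open>r\<close> only have to stay as they are, and only the new edges have to be checked for
    meeting \<open>{..r}\<close>.\<close>
  have no_improvement: False if "simple_graph {..<n} E'" "\<And>v. v < n \<Longrightarrow> degree E' v \<le> f v"
    "\<And>v. v < r \<Longrightarrow> degree E' v = degree E v" "degree E r < degree E' r"
    "\<And>v w. {v, w} \<in> E' \<Longrightarrow> {v, w} \<in> E \<or> v \<le> r \<or> w \<le> r" for E'
  proof -
    have "partial_realization f n r E'"
      unfolding partial_realization_def
    proof (intro conjI allI impI)
      fix v w assume "{v, w} \<in> E'"
      then show "v \<le> r \<or> w \<le> r"
        using that(5)[of v w] low[of v w] by auto
    qed (use that eq in auto)
    then show False
      using stuck[of E'] that(4) by simp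
  qed
  \<comment> \<open>A saturated \<open>i\<close> has degree \<open>f i \<ge> f r\<close>, which
    exceeds the degree of the deficient \<open>r\<close>.\<close>
  have excess: "\<exists>u. {i, u} \<in> E \<and> {r, u} \<notin> E \<and> u \<noteq> r" if "i < r" for i
  proof -
    have "degree E r < degree E i"
      using eq[OF that] mono[of i r] less that \<open>r < n\<close> by simp
    then show ?thesis
      by (rule private_neighbour[OF E]) (intro exI conjI)
  qed
  have open_edge: "{r, k} \<in> E" if k: "r < k" "k < n" "degree E k < f k" for k
  proof (rule ccontr)
    assume *: "{r, k} \<notin> E"
    have deg: "degree (insert {r, k} E) v = degree E v + of_bool (v = r) + of_bool (v = k)" for v
      using degree_insert[OF fin *, of v] k(1) by (cases "v = r"; cases "v = k") auto
    show False
    proof (rule no_improvement[of "insert {r, k} E"])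
      show "degree (insert {r, k} E) v \<le> f v" if "v < n" for v
        using le[OF that] less k(1,3) by (auto simp: deg)
    qed (use k \<open>r < n\<close> E in \<open>auto simp: deg doubleton_eq_iff\<close>)
  qed
  have adj: "{i, r} \<in> E" if i: "i < r" for i
  proof (rule ccontr)
    assume *: "{i, r} \<notin> E"
    obtain u where u: "{i, u} \<in> E" "{r, u} \<notin> E" "u \<noteq> r"
      using excess[OF i] by (elim exE conjE) (rule that)
    have "u \<noteq> i"
      using mem(3)[OF u(1)] by simp
    \<comment> \<open>The exchange with \<open>k = r\<close>: both new edges end in
      \<open>r\<close>, so its degree grows by two.\<close>
    define E' where "E' = insert {r, u} (insert {i, r} (E - {{i, u}}))"
    have deg: "degree E' v = degree E v + 2 * of_bool (v = r)" for v
      unfolding E'_def using degree_edge_exchange[OF E u * _ u(3)[symmetric], of v] i by simp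
    have E': "simple_graph {..<n} E'"
      using E mem[OF u(1)] u i \<open>r < n\<close> by (simp add: E'_def simple_graph_Diff)
    have low': "{v, w} \<in> E \<or> v \<le> r \<or> w \<le> r" if "{v, w} \<in> E'" for v w
      using that by (auto simp: E'_def doubleton_eq_iff)
    show False
    proof (cases "degree E r + 2 \<le> f r")
      case True
      show False
        by (rule no_improvement[OF E']) (use True le less low' in \<open>auto simp: deg\<close>)
    next
      text \<open>With deficit one the exchange overshoots; by parity some later vertex \<^term>\<open>k\<close> is
        deficient too, and dropping the edge to \<^term>\<open>k\<close> makes up for it.\<close>
      case False
      then have defic: "f r = degree E r + 1"
        using less by simp
      have "\<exists>k. r < k \<and> k < n \<and> degree E k < f k"
      proof (rule ccontr)
        assume none: "\<not> ?thesis"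
        have "f v = degree E v + of_bool (v = r)" if "v < n" for v
        proof (cases v r rule: linorder_cases)
          case greater
          then show ?thesis
            using none le[OF that] that by (cases "degree E v < f v") auto
        qed (use eq defic in auto)
        then have "(\<Sum>v<n. f v) = (\<Sum>v<n. degree E v) + 1"
          using \<open>r < n\<close> by (simp add: sum.distrib)
        then show False
          using even even_sum_degree[OF E] by simp
      qed
      then obtain k where k: "r < k" "k < n" "degree E k < f k"
        by (elim exE conjE) (rule that)
      have rk: "{r, k} \<in> E"
        using open_edge[OF k] .
      have "k \<noteq> u" using rk u(2) by auto
      then have rk': "{r, k} \<in> E'"
        using rk i u(3) k by (auto simp: E'_def doubleton_eq_iff)
      have fin': "finite E'"
        using simple_graph_finite(2)[OF E'] .
      have pos: "degree E k > 0"
        using degree_pos[OF fin rk] by simp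
      have deg': "degree (E' - {{r, k}}) v = degree E v + of_bool (v = r) - of_bool (v = k)" for v
        using degree_remove[OF fin' rk', of v] k pos by (auto simp: deg)
      show False
      proof (rule no_improvement[of "E' - {{r, k}}"])
        show "degree (E' - {{r, k}}) v \<le> f v" if "v < n" for v
          using le[OF that] less by (auto simp: deg')
      qed (use k low' simple_graph_Diff[OF E'] in \<open>auto simp: deg'\<close>)
    qed
  qed
  \<comment> \<open>All neighbours of \<open>k\<close> lie in \<open>{..r}\<close>. If
    \<open>k\<close> falls short of both bounds, it misses some \<open>i \<le> r\<close>;
    \<open>open_edge\<close> excludes \<open>i = r\<close>, and the exchange at \<open>i\<close>
    raises \<open>r\<close> and \<open>k\<close> by one each.\<close>
  have deg_high: "degree E k = min (r + 1) (f k)" if k: "r < k" "k < n" for k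
  proof (rule ccontr)
    assume ne: "\<not> ?thesis"
    have sub: "{w. {k, w} \<in> E} \<subseteq> {..r}"
      using low k by force
    have "degree E k \<le> r + 1"
      using card_mono[OF _ sub] degree_eq_card_neighbours[OF E, of k] by simp
    then have lt: "degree E k < r + 1" "degree E k < f k"
      using ne le[OF k(2)] by (auto simp: min_def split: if_splits)
    have rk: "{r, k} \<in> E"
      using open_edge[OF k lt(2)] .
    have "{w. {k, w} \<in> E} \<noteq> {..r}"
      using lt(1) degree_eq_card_neighbours[OF E, of k] by auto
    then obtain i where i: "i \<le> r" "{k, i} \<notin> E"
      using sub by auto
    have "i < r"
      using i rk by (cases "i = r") (auto simp: insert_commute)
    obtain u where u: "{i, u} \<in> E" "{r, u} \<notin> E" "u \<noteq> r"
      using excess[OF \<open>i < r\<close>] by (elim exE conjE) (rule that)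
    have ik: "{i, k} \<notin> E" "k \<noteq> u" "i \<noteq> r"
      using i rk u \<open>i < r\<close> by (auto simp: insert_commute)
    define E' where "E' = insert {r, u} (insert {i, k} (E - {{i, u}}))"
    have deg: "degree E' v = degree E v + of_bool (v = r) + of_bool (v = k)" for v
      unfolding E'_def using degree_edge_exchange[OF E u ik(1,3,2), of v] k \<open>i < r\<close> by simp
    show False
    proof (rule no_improvement[of E'])
      show "simple_graph {..<n} E'"
        using E mem[OF u(1)] u k \<open>i < r\<close> \<open>r < n\<close> by (simp add: E'_def simple_graph_Diff)
      show "degree E' v \<le> f v" if "v < n" for v
        using le[OF that] less lt k by (auto simp: deg)
      show "{v, w} \<in> E \<or> v \<le> r \<or> w \<le> r" if "{v, w} \<in> E'" for v w
        using that \<open>i < r\<close> by (auto simp: E'_def doubleton_eq_iff)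
    qed (use k in \<open>auto simp: deg\<close>)
  qed
  \<comment> \<open>For a missing \<open>{i, j}\<close>, both endpoints have private neighbours
    \<open>u\<close> and \<open>w\<close>, which come after \<open>r\<close> because
    \<open>r\<close> is adjacent to everything earlier. Dropping \<open>{j, w}\<close> and then
    exchanging at \<open>i\<close> restores the degree of \<open>j\<close>; the net effect is a gain
    at \<open>r\<close> and a loss at \<open>w\<close>.\<close>
  have adj_low: "{i, j} \<in> E" if ij: "i < j" "j < r" for i j
  proof (rule ccontr)
    assume *: "{i, j} \<notin> E"
    have "i < r" using ij by simp
    obtain u where u: "{i, u} \<in> E" "{r, u} \<notin> E" "u \<noteq> r"
      using excess[OF \<open>i < r\<close>] by (elim exE conjE) (rule that)
    obtain w where w: "{j, w} \<in> E" "{r, w} \<notin> E" "w \<noteq> r"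
      using excess[OF \<open>j < r\<close>] by (elim exE conjE) (rule that)
    have "r < x" if "{r, x} \<notin> E" "x \<noteq> r" for x
      using adj[of x] that by (cases "x < r") (auto simp: insert_commute)
    then have gt: "r < u" "r < w"
      using u(2,3) w(2,3) by auto
    have pos: "degree E i > 0" "degree E j > 0"
      using degree_pos[OF fin u(1)] degree_pos[OF fin w(1)] by auto
    define F where "F = E - {{j, w}}"
    have F: "simple_graph {..<n} F"
      unfolding F_def using E by (rule simple_graph_Diff)
    have "{i, u} \<in> F" "{r, u} \<notin> F" "u \<noteq> r" "{i, j} \<notin> F" "i \<noteq> r" "j \<noteq> u"
      using u * ij gt by (auto simp: F_def doubleton_eq_iff)
    note exchange = degree_edge_exchange[OF F this]
    define E' where "E' = insert {r, u} (insert {i, j} (F - {{i, u}}))"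
    have deg: "degree E' v = degree E v + of_bool (v = r) - of_bool (v = w)" for v
      unfolding E'_def exchange using degree_remove[OF fin w(1), of v] pos ij gt
      by (auto simp: F_def)
    show False
    proof (rule no_improvement[of E'])
      show "simple_graph {..<n} E'"
        using F mem[OF u(1)] u ij \<open>r < n\<close> by (simp add: E'_def simple_graph_Diff)
      show "degree E' v \<le> f v" if "v < n" for v
        using le[OF that] less by (auto simp: deg)
      show "{v, w} \<in> E \<or> v \<le> r \<or> w \<le> r" if "{v, w} \<in> E'" for v w
        using that ij by (auto simp: E'_def F_def doubleton_eq_iff)
    qed (use gt in \<open>auto simp: deg\<close>)
  qed
  have "clique {..r} E"
    unfolding clique_def
  proof (intro ballI impI)
    fix v w assume vw: "v \<in> {..r}" "w \<in> {..r}" "v \<noteq> w"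
    have edge: "{i, j} \<in> E" if "i < j" "j \<le> r" for i j
      using adj[of i] adj_low[of i j] that by (cases "j = r") auto
    show "{v, w} \<in> E"
    proof (cases v w rule: linorder_cases)
      case greater
      then show ?thesis
        using edge[of w v] vw by (simp add: insert_commute)
    qed (use edge[of v w] vw in simp_all)
  qed
  moreover have "indep {r<..<n} E"
    unfolding indep_def
  proof (intro ballI impI notI)
    fix v w assume "v \<in> {r<..<n}" "w \<in> {r<..<n}" "{v, w} \<in> E"
    then show False
      using low[of v w] by auto
  qed
  moreover have V: "{..<n} = {..r} \<union> {r<..<n}"
    using \<open>r < n\<close> by auto
  \<comment> \<open>The degrees of \<open>E\<close> thus satisfy the inequality at \<open>r\<close>
    with equality; the deficit of \<open>r\<close> makes it fail for \<open>f\<close>.\<close>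
  ultimately have "(\<Sum>v\<le>r. int (degree E v)) - (\<Sum>v\<in>{r<..<n}. int (degree E v))
      = 2 * int (card {..r} choose 2)"
    using E by (intro split_degree_sum_difference) (simp_all add: disjoint_iff)
  also have "2 * int (card {..r} choose 2) = int (r * (r + 1))"
  proof -
    have "2 * (Suc r choose 2) = r * (r + 1)"
      using dvd_mult_div_cancel[of 2 "Suc r * r"] by (simp add: choose_two algebra_simps)
    then show ?thesis
      unfolding card_atMost by linarith
  qed
  finally have "int (\<Sum>v\<le>r. degree E v) = int (r * (r + 1) + (\<Sum>v\<in>{r<..<n}. degree E v))"
    unfolding of_nat_sum of_nat_add by linarith
  then have "(\<Sum>v\<le>r. degree E v) = r * (r + 1) + (\<Sum>v\<in>{r<..<n}. degree E v)"
    by (simp only: of_nat_eq_iff)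
  also have "(\<Sum>v\<in>{r<..<n}. degree E v) = (\<Sum>v\<in>{r<..<n}. min (r + 1) (f v))"
    by (intro sum.cong) (auto simp: deg_high)
  moreover have "(\<Sum>v\<le>r. degree E v) < (\<Sum>v\<le>r. f v)"
    using le less \<open>r < n\<close> by (intro sum_strict_mono_ex1) auto
  ultimately show ?thesis
    by simp
qed

lemma partial_realization_exists:
  fixes f :: "nat \<Rightarrow> nat"
  assumes mono: "\<And>i j. i \<le> j \<Longrightarrow> j < n \<Longrightarrow> f j \<le> f i"
    and even: "even (\<Sum>v<n. f v)"
    and eg: "\<And>r. r < n \<Longrightarrow> (\<Sum>v\<le>r. f v) \<le> r * (r + 1) + (\<Sum>v\<in>{r<..<n}. min (r + 1) (f v))"
  shows "r \<le> n \<Longrightarrow> \<exists>E. partial_realization f n r E"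
proof (induction r)
  case 0
  have "partial_realization f n 0 {}"
    by (simp add: partial_realization_def simple_graph_def degree_def)
  then show ?case ..
next
  case (Suc r)
  then have "r < n" and "\<exists>E. partial_realization f n r E"
    by auto
  then obtain E0 where "partial_realization f n r E0"
    by (elim exE)
  \<comment> \<open>The degree of \<open>r\<close> is bounded by \<open>f r\<close>, so a partial
    realization maximizing it exists.\<close>
  then have "\<exists>E. partial_realization f n r E \<and>
      (\<forall>E'. partial_realization f n r E' \<longrightarrow> degree E' r \<le> degree E r)"
    using \<open>r < n\<close> by (intro ex_has_greatest_nat[where b = "f r + 1"])
      (auto simp: partial_realization_def less_Suc_eq_le)
  then obtain E where E: "partial_realization f n r E"
    and max: "\<And>E'. partial_realization f n r E' \<Longrightarrow> degree E' r \<le> degree E r"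
    by auto
  have "degree E r \<le> f r"
    using E \<open>r < n\<close> by (simp add: partial_realization_def)
  moreover have "\<not> degree E r < f r"
  proof
    assume "degree E r < f r"
    from stuck_partial_realization[OF E \<open>r < n\<close> mono even this max] eg[OF \<open>r < n\<close>]
    show False by simp
  qed
  ultimately have "degree E r = f r"
    by simp
  then have "partial_realization f n (Suc r) E"
    using E by (auto simp: partial_realization_def less_Suc_eq le_Suc_eq)
  then show ?case ..
qed

text \<open>Indices start at 0, so the inequality at \<open>r\<close> is the usual one for the first
  \<open>r + 1\<close> entries. A partial realization at \<open>n\<close> has every vertex
  saturated.\<close>

lemma erdos_gallai_sufficiency:
  fixes f :: "nat \<Rightarrow> nat"
  assumes "\<And>i j. i \<le> j \<Longrightarrow> j < n \<Longrightarrow> f j \<le> f i"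
    and "even (\<Sum>v<n. f v)"
    and "\<And>r. r < n \<Longrightarrow> (\<Sum>v\<le>r. f v) \<le> r * (r + 1) + (\<Sum>v\<in>{r<..<n}. min (r + 1) (f v))"
  shows "\<exists>E. simple_graph {..<n} E \<and> (\<forall>v<n. degree E v = f v)"
proof -
  have "\<exists>E. partial_realization f n n E"
    using assms by (intro partial_realization_exists) simp_all
  then show ?thesis
    by (auto simp: partial_realization_def)
qed

section \<open>Numerical consequences of a non-graphic member\<close>

lemma realizes_lessThan:
  assumes "simple_graph {..<n} E" "length d = n" "\<And>v. v < n \<Longrightarrow> d ! v = int (degree E v)"
  shows "realizes {..<n} E d"
proof -
  have "d = map (\<lambda>v. int (degree E v)) [0..<n]"
    using assms by (intro nth_equalityI) auto
  then show ?thesis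
    using assms(1) by (simp add: realizes_def atLeast0LessThan)
qed

text \<open>Supplies the parameters of the split graph: \<open>k\<close> is the number of entries on
  the larger side of the violated inequality, and \<open>c1 - (k - 1)\<close> is the room that a
  clique vertex has for cross edges.\<close>

lemma non_graphic_interval_bound:
  assumes "d \<in> \<D> n (int c1) (int c2)" "\<not> graphic d" "c1 < n"
  obtains k where "c2 < k" "k \<le> n" "k - 1 \<le> c1" "(n - k) * c2 \<le> k * (c1 - (k - 1))"
proof -
  define f where "f v = nat (d ! v)" for v
  have len: "length d = n" and sorted: "sorted_wrt (\<ge>) d" and "even (sum_list d)"
    and "\<forall>x\<in>set d. int c2 \<le> x \<and> x \<le> int c1"
    using assms(1) by (auto simp: degree_interval_def)
  then have bounds: "int c2 \<le> d ! v" "d ! v \<le> int c1" if "v < n" for v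
    using that by auto
  have nth: "d ! v = int (f v)" if "v < n" for v
    using bounds(1)[OF that] by (simp add: f_def)
  have f: "c2 \<le> f v" "f v \<le> c1" if "v < n" for v
    using bounds[OF that] nth[OF that] by auto
  have "sum_list d = int (\<Sum>v<n. f v)"
    using nth len by (simp add: sum_list_sum_nth atLeast0LessThan)
  then have even: "even (\<Sum>v<n. f v)"
    using \<open>even (sum_list d)\<close> by (simp only: even_of_nat)
  have mono: "f j \<le> f i" if "i \<le> j" "j < n" for i j
    using that sorted_wrt_nth_less[OF sorted, of i j] len
    by (cases "i = j") (auto simp: f_def)
  have "\<exists>r<n. r * (r + 1) + (\<Sum>v\<in>{r<..<n}. min (r + 1) (f v)) < (\<Sum>v\<le>r. f v)"
  proof (rule ccontr)
    assume none: "\<not> ?thesis"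
    have "\<exists>E. simple_graph {..<n} E \<and> (\<forall>v<n. degree E v = f v)"
    proof (rule erdos_gallai_sufficiency[OF mono even])
      fix r assume "r < n"
      then show "(\<Sum>v\<le>r. f v) \<le> r * (r + 1) + (\<Sum>v\<in>{r<..<n}. min (r + 1) (f v))"
        using none by (intro leI) auto
    qed
    then obtain E where "simple_graph {..<n} E" "\<forall>v<n. degree E v = f v"
      by auto
    then have "realizes {..<n} E d"
      using nth len by (intro realizes_lessThan) auto
    then show False
      using assms(2) by (auto simp: graphic_def)
  qed
  then obtain r where r: "r < n"
    and excess: "r * (r + 1) + (\<Sum>v\<in>{r<..<n}. min (r + 1) (f v)) < (\<Sum>v\<le>r. f v)"
    by auto
  have "(n - (r + 1)) * min (r + 1) c2 \<le> (\<Sum>v\<in>{r<..<n}. min (r + 1) (f v))"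
    using sum_bounded_below[of "{r<..<n}" "min (r + 1) c2" "\<lambda>v. min (r + 1) (f v)"] f(1)
    by fastforce
  moreover have "(\<Sum>v\<le>r. f v) \<le> (r + 1) * c1"
    using sum_bounded_above[of "{..r}" f c1] f(2) r by simp
  ultimately have *: "r * (r + 1) + (n - (r + 1)) * min (r + 1) c2 < (r + 1) * c1"
    using excess by linarith
  \<comment> \<open>Otherwise every minimum is \<open>r + 1\<close>; cancelling this factor leaves
    \<open>n - 1 < c1\<close>, against \<open>c1 < n\<close>.\<close>
  have "c2 < r + 1"
  proof (rule ccontr)
    assume "\<not> c2 < r + 1"
    then have "(r + 1) * (r + (n - (r + 1))) < (r + 1) * c1"
      using * by (simp add: algebra_simps min_def)
    then have "r + (n - (r + 1)) < c1"
      by (simp only: mult_less_cancel1)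
    then show False
      using r assms(3) by simp
  qed
  moreover from this have **: "r * (r + 1) + (n - (r + 1)) * c2 < (r + 1) * c1"
    using * by simp
  then have "(r + 1) * r < (r + 1) * c1"
    by (simp add: algebra_simps)
  then have "r < c1"
    by (simp only: mult_less_cancel1)
  moreover have "(n - (r + 1)) * c2 \<le> (r + 1) * (c1 - r)"
    using ** by (simp add: diff_mult_distrib2 algebra_simps)
  ultimately show thesis
    using r by (intro that[of "r + 1"]) auto
qed

section \<open>Split graphs with evenly spread cross edges\<close>

text \<open>Equal quotients by \<open>c\<close> put the numbers less than \<open>c\<close>, hence
  less than \<open>k\<close>, apart; being congruent modulo \<open>k\<close>, they coincide. This
  keeps the cyclically assigned cross edges distinct.\<close>

lemma eq_if_div_mod_eq:
  fixes s t c k :: nat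
  assumes "s div c = t div c" "s mod k = t mod k" "0 < c" "c < k"
  shows "s = t"
proof -
  have aux: "x = y" if "x \<le> y" "x div c = y div c" "x mod k = y mod k" for x y
  proof -
    have "k dvd y - x"
      using that mod_eq_dvd_iff_nat[of x y k] by simp
    moreover have "y < c * (y div c) + c" "c * (x div c) \<le> x"
      using \<open>0 < c\<close> mod_less_divisor[of c y] mult_div_mod_eq[of c y] mult_div_mod_eq[of c x]
      by linarith+
    then have "y - x < k"
      using that assms(4) by simp
    ultimately show ?thesis
      using that(1) nat_dvd_not_less[of "y - x" k] by auto
  qed
  show ?thesis
  proof (cases "s \<le> t")
    case True
    then show ?thesis
      using assms(1,2) by (rule aux)
  next
    case False
    then have "t \<le> s"
      by simp
    then have "t = s"
      using assms(1,2)[symmetric] by (rule aux)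
    then show ?thesis ..
  qed
qed

text \<open>The independent vertices claim their neighbours in the clique cyclically, each continuing where
  its predecessor stopped, so the cross edges are spread evenly over the clique.\<close>

lemma balanced_split_graph:
  fixes c k n q :: nat
  assumes "c < k" "k \<le> n" "(n - k) * c \<le> k * q"
  obtains E where "split_graph {..<n} E"
    "\<forall>v\<in>{..<k}. degree E v \<in> {k - 1..k - 1 + q}" "\<forall>v\<in>{k..<n}. degree E v = c"
proof -
  \<comment> \<open>There are \<open>m\<close> cross edges. Edge \<open>s\<close> takes its clique
    end cyclically from \<open>s mod k\<close>, while each run of \<open>c\<close> consecutive
    \<open>s\<close> shares one independent end.\<close>
  define m where "m = (n - k) * c"
  define g where "g s = {s mod k, k + s div c}" for s
  define E where "E = [{..<k}]\<^bsup>2\<^esup> \<union> g ` {..<m}"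
  have mod: "s mod k < k" for s
    using assms(1) by simp
  have m_pos: "0 < c" "s div c < n - k" if "s < m" for s
  proof -
    show "0 < c"
      using that by (cases c) (auto simp: m_def)
    then show "s div c < n - k"
      using that by (simp add: m_def div_less_iff_less_mult)
  qed
  have mem_g_low: "v \<in> g s \<longleftrightarrow> s mod k = v" if "v < k" for v s
    using that by (auto simp: g_def)
  have mem_g_high: "v \<in> g s \<longleftrightarrow> s div c = v - k" if "k \<le> v" for v s
    using that mod[of s] by (auto simp: g_def)
  have inj: "inj_on g {..<m}"
  proof (rule inj_onI)
    fix s t assume st: "s \<in> {..<m}" "t \<in> {..<m}" "g s = g t"
    then have "s mod k = t mod k" "s div c = t div c"
      using mod[of s] mod[of t] by (auto simp: g_def doubleton_eq_iff)
    then show "s = t"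
      using st m_pos(1)[of s] assms(1) by (intro eq_if_div_mod_eq[of s c t k]) auto
  qed
  have disj: "[{..<k}]\<^bsup>2\<^esup> \<inter> g ` {..<m} = {}"
    using mod by (auto simp: g_def)
  have clique: "simple_graph {..<k} ([{..<k}]\<^bsup>2\<^esup>)"
    by (simp add: simple_graph_def)
  have deg: "degree E v = degree ([{..<k}]\<^bsup>2\<^esup>) v + card {s. s < m \<and> v \<in> g s}" for v
  proof -
    have "{e \<in> E. v \<in> e} = {e \<in> [{..<k}]\<^bsup>2\<^esup>. v \<in> e} \<union> g ` {s. s < m \<and> v \<in> g s}"
      by (auto simp: E_def)
    moreover have "{e \<in> [{..<k}]\<^bsup>2\<^esup>. v \<in> e} \<inter> g ` {s. s < m \<and> v \<in> g s} = {}"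
      using disj by auto
    moreover have "finite {e \<in> [{..<k}]\<^bsup>2\<^esup>. v \<in> e}"
      using simple_graph_finite(2)[OF clique] by simp
    ultimately have "degree E v
        = degree ([{..<k}]\<^bsup>2\<^esup>) v + card (g ` {s. s < m \<and> v \<in> g s})"
      unfolding degree_def by (simp add: card_Un_disjoint)
    also have "card (g ` {s. s < m \<and> v \<in> g s}) = card {s. s < m \<and> v \<in> g s}"
      by (intro card_image inj_on_subset[OF inj]) auto
    finally show ?thesis .
  qed
  have deg_clique: "degree ([{..<k}]\<^bsup>2\<^esup>) v = (if v < k then k - 1 else 0)" for v
  proof -
    have "{w. {v, w} \<in> [{..<k}]\<^bsup>2\<^esup>} = (if v < k then {..<k} - {v} else {})"
      by auto
    then show ?thesis
      by (simp add: degree_eq_card_neighbours[OF clique])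
  qed
  show thesis
  proof (rule that[of E])
    have "g s \<in> [{..<n}]\<^bsup>2\<^esup>" if "s < m" for s
      using mod[of s] m_pos(2)[OF that] assms(2) by (simp add: g_def)
    moreover have "[{..<k}]\<^bsup>2\<^esup> \<subseteq> [{..<n}]\<^bsup>2\<^esup>"
      using assms(2) by (intro nsets_mono) auto
    ultimately have "simple_graph {..<n} E"
      by (auto simp: simple_graph_def E_def)
    moreover have "clique {..<k} E"
      by (simp add: clique_def E_def)
    moreover have "indep {k..<n} E"
      unfolding indep_def
    proof (intro ballI impI notI)
      fix v w assume vw: "v \<in> {k..<n}" "w \<in> {k..<n}" "{v, w} \<in> E"
      then obtain s where "{v, w} = {s mod k, k + s div c}"
        by (auto simp: E_def g_def)
      then show False
        using mod[of s] vw by (auto simp: doubleton_eq_iff)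
    qed
    moreover have "{..<k} \<union> {k..<n} = {..<n}" "{..<k} \<inter> {k..<n} = {}"
      using assms(2) by auto
    ultimately show "split_graph {..<n} E"
      by (intro split_graphI)
    show "\<forall>v\<in>{..<k}. degree E v \<in> {k - 1..k - 1 + q}"
    proof
      fix v assume "v \<in> {..<k}"
      then have v: "v < k" by simp
      \<comment> \<open>The remainder modulo \<open>k\<close> being fixed to \<open>v\<close>,
        \<open>s\<close> is determined by \<open>s div k\<close>, which is below \<open>q\<close>
        because \<open>s < m \<le> k * q\<close>.\<close>
      have "card {s. s < m \<and> v \<in> g s} \<le> card {..<q}"
      proof (rule card_inj_on_le)
        show "inj_on (\<lambda>s. s div k) {s. s < m \<and> v \<in> g s}"
          by (rule inj_onI) (metis (mono_tags) mem_Collect_eq mem_g_low[OF v] div_mult_mod_eq)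
        show "(\<lambda>s. s div k) ` {s. s < m \<and> v \<in> g s} \<subseteq> {..<q}"
          using assms(1,3) by (auto simp: m_def div_less_iff_less_mult mult.commute)
      qed simp
      then show "degree E v \<in> {k - 1..k - 1 + q}"
        using v unfolding deg deg_clique by auto
    qed
    show "\<forall>v\<in>{k..<n}. degree E v = c"
    proof
      fix v assume "v \<in> {k..<n}"
      then have v: "k \<le> v" "v < n" by auto
      \<comment> \<open>The run of \<open>v\<close> is a full block of length \<open>c\<close>: it
        ends by \<open>m\<close> since \<open>v < n\<close>. For \<open>c = 0\<close> both sides are
        empty.\<close>
      have "{s. s < m \<and> v \<in> g s} = {(v - k) * c..<(v - k) * c + c}"
      proof (cases "c = 0")
        case False
        have "(v - k) * c + c \<le> m"
        proof -
          have "v - k + 1 \<le> n - k"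
            using v by linarith
          then have "(v - k + 1) * c \<le> (n - k) * c"
            by (rule mult_le_mono1)
          then show ?thesis
            by (simp add: m_def add.commute)
        qed
        moreover have "v \<in> g s \<longleftrightarrow> (v - k) * c \<le> s \<and> s < (v - k) * c + c" for s
        proof -
          have "v - k \<le> s div c \<longleftrightarrow> (v - k) * c \<le> s"
            using False by (simp add: less_eq_div_iff_mult_less_eq)
          moreover have "s div c < Suc (v - k) \<longleftrightarrow> s < Suc (v - k) * c"
            using False by (intro div_less_iff_less_mult) simp
          ultimately show ?thesis
            unfolding mem_g_high[OF v(1)] by (simp only: mult_Suc add.commute) linarith
        qed
        ultimately show ?thesis
          by (intro set_eqI) (simp, linarith)
      qed (simp add: m_def)
      then show "degree E v = c"
        using v by (simp add: deg deg_clique)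
    qed
  qed
qed

theorem theorem5p3:
  fixes n c1 c2 :: nat
  assumes "n > c1" and "c1 \<ge> c2"
    and "\<not> fully_graphic (\<D> n (int c1) (int c2))"
  shows "\<exists>d \<in> \<D> n (int c1) (int c2). split_degree_sequence d"
proof -
  obtain d0 where "d0 \<in> \<D> n (int c1) (int c2)" "\<not> graphic d0"
    using assms(3) by (auto simp: fully_graphic_def)
  then obtain k where k: "c2 < k" "k \<le> n" "k - 1 \<le> c1" "(n - k) * c2 \<le> k * (c1 - (k - 1))"
    using assms(1) by (rule non_graphic_interval_bound)
  obtain E where split: "split_graph {..<n} E"
    and degs: "\<forall>v\<in>{..<k}. degree E v \<in> {k - 1..k - 1 + (c1 - (k - 1))}"
      "\<forall>v\<in>{k..<n}. degree E v = c2"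
    using k(1,2,4) by (rule balanced_split_graph)
  \<comment> \<open>On the clique, \<open>c2 < k\<close> gives the lower bound, and
    \<open>k - 1 \<le> c1\<close> makes \<open>k - 1 + (c1 - (k - 1))\<close> equal to
    \<open>c1\<close>.\<close>
  have bounds: "c2 \<le> degree E v \<and> degree E v \<le> c1" if "v < n" for v
    using bspec[OF degs(1), of v] bspec[OF degs(2), of v] k(1,3) assms(2) that
    by (cases "v < k") auto
  have E: "simple_graph {..<n} E"
    using split by (simp add: split_graph_def)
  \<comment> \<open>Sorting is harmless because \<open>realizes\<close> compares only multisets of
    degrees.\<close>
  define d where "d = rev (sort (map (\<lambda>v. int (degree E v)) [0..<n]))"
  have mset_d: "mset d = image_mset (\<lambda>v. int (degree E v)) (mset_set {..<n})"
    by (simp add: d_def atLeast0LessThan)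
  then have "sum_list d = (\<Sum>v<n. int (degree E v))"
    by (simp only: sum_unfold_sum_mset flip: sum_mset_sum_list)
  then have "sum_list d = int (\<Sum>v<n. degree E v)"
    by (simp only: of_nat_sum)
  then have "even (sum_list d)"
    using even_sum_degree[OF E] by (simp only: even_of_nat)
  moreover have "sorted_wrt (\<ge>) d"
    by (simp add: d_def sorted_wrt_rev)
  ultimately have "d \<in> \<D> n (int c1) (int c2)"
    using bounds by (auto simp: degree_interval_def d_def)
  moreover have "realizes {..<n} E d"
    using E mset_d by (simp add: realizes_def)
  ultimately show ?thesis
    using split_degree_sequence_if_split_realization split by blast
qed

end
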